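(* Let $k\ge 2$. The map $$\Phi:(\mathcal P_k\times\mathcal P_k)/SL_k(\mathbb Z)\to \mathbb{SL}_k,\qquad (\gamma,\delta)\mapsto \mathcal M=(m_{i\,j})_{i,j\in\mathbb Z},\qquad m_{i\,j}=\det(\gamma_i,\gamma_{i+1},\ldots,\gamma_{i+k-2},\delta_j),$$ is a bijection between pairs of paths modulo the diagonal action of $SL_k(\mathbb Z)$ and tame $SL_k$-tilings.
   Context: A path is a bi-infinite sequence $\gamma=(\gamma_i)_{i\in\mathbb Z}$ of column vectors $\gamma_i\in\mathbb Z^k$ such that for every $i\in\mathbb Z$ the $k\times k$ matrix $(\gamma_i,\ldots,\gamma_{i+k-1})$ lies in $SL_k(\mathbb Z)$; $\mathcal P_k$ is the set of all paths. For $A\in SL_k(\mathbb Z)$, $A\gamma:=(A\gamma_i)_{i\in\mathbb Z}\in\mathcal P_k$; $SL_k(\mathbb Z)$ acts diagonally on $\mathcal P_k\times\mathcal P_k$ by $A\cdot(\gamma,\delta)=(A\gamma,A\delta)$. An $SL_k$-tiling is an array $\mathcal M=(m_{i\,j})_{i,j\in\mathbb Z}$ of integers such that every adjacent $k\times k$ submatrix (rows $i,\ldots,i+k-1$, columns $j,\ldots,j+k-1$) has determinant $1$. It is tame if every adjacent $(k+1)\times(k+1)$ submatrix has determinant $0$. $\mathbb{SL}_k$ is the set of all tame $SL_k$-tilings. *)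

theory Defs
  imports "Jordan_Normal_Form.Determinant"
begin

definition SL :: "nat \<Rightarrow> int mat set" where
  "SL k = {A \<in> carrier_mat k k. det A = 1}"

definition paths :: "nat \<Rightarrow> (int \<Rightarrow> int vec) set" where
  "paths k = {\<gamma>. (\<forall>i. \<gamma> i \<in> carrier_vec k) \<and>
                   (\<forall>i. mat_of_cols k (map (\<lambda>a. \<gamma> (i + int a)) [0..<k]) \<in> SL k)}"

definition path_act :: "int mat \<Rightarrow> (int \<Rightarrow> int vec) \<Rightarrow> (int \<Rightarrow> int vec)" where
  "path_act A \<gamma> = (\<lambda>i. A *\<^sub>v \<gamma> i)"

text \<open>Two pairs of paths are related iff they lie in the same orbit of the diagonal action, so the
  orbit space is the quotient of \<open>paths k \<times> paths k\<close> by this relation.\<close>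

definition orbit_rel ::
  "nat \<Rightarrow> (((int \<Rightarrow> int vec) \<times> (int \<Rightarrow> int vec)) \<times> ((int \<Rightarrow> int vec) \<times> (int \<Rightarrow> int vec))) set" where
  "orbit_rel k = {((\<gamma>, \<delta>), (\<gamma>', \<delta>')).
     (\<gamma>, \<delta>) \<in> paths k \<times> paths k \<and> (\<gamma>', \<delta>') \<in> paths k \<times> paths k \<and>
     (\<exists>A \<in> SL k. \<gamma>' = path_act A \<gamma> \<and> \<delta>' = path_act A \<delta>)}"

definition adj_submat :: "nat \<Rightarrow> (int \<Rightarrow> int \<Rightarrow> int) \<Rightarrow> int \<Rightarrow> int \<Rightarrow> int mat" where
  "adj_submat n M i j = mat n n (\<lambda>(a, b). M (i + int a) (j + int b))"

definition SL_tiling :: "nat \<Rightarrow> (int \<Rightarrow> int \<Rightarrow> int) \<Rightarrow> bool" where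
  "SL_tiling k M \<longleftrightarrow> (\<forall>i j. det (adj_submat k M i j) = 1)"

definition tame :: "nat \<Rightarrow> (int \<Rightarrow> int \<Rightarrow> int) \<Rightarrow> bool" where
  "tame k M \<longleftrightarrow> (\<forall>i j. det (adj_submat (k + 1) M i j) = 0)"

definition tame_SL_tilings :: "nat \<Rightarrow> (int \<Rightarrow> int \<Rightarrow> int) set" where
  "tame_SL_tilings k = {M. SL_tiling k M \<and> tame k M}"

definition tiling_of :: "nat \<Rightarrow> (int \<Rightarrow> int vec) \<times> (int \<Rightarrow> int vec) \<Rightarrow> (int \<Rightarrow> int \<Rightarrow> int)" where
  "tiling_of k = (\<lambda>(\<gamma>, \<delta>) i j.
     det (mat_of_cols k (map (\<lambda>a. \<gamma> (i + int a)) [0..<k - 1] @ [\<delta> j])))"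

text \<open>The map induced by \<open>tiling_of k\<close> on orbits: the common value on an orbit. This is meaningful
  when \<open>tiling_of k\<close> respects \<open>orbit_rel k\<close>; on other sets of pairs \<open>the_elem\<close> is unspecified.\<close>

definition Phi ::
  "nat \<Rightarrow> ((int \<Rightarrow> int vec) \<times> (int \<Rightarrow> int vec)) set \<Rightarrow> (int \<Rightarrow> int \<Rightarrow> int)" where
  "Phi k C = the_elem (tiling_of k ` C)"

lemma SL_one: "1\<^sub>m k \<in> SL k"
  by (simp add: SL_def)

lemma SL_mult: "A \<in> SL k \<Longrightarrow> B \<in> SL k \<Longrightarrow> A * B \<in> SL k"
  by (auto simp: SL_def det_mult)

lemma SL_inverse:
  assumes "A \<in> SL k"
  obtains B where "B \<in> SL k" "B * A = 1\<^sub>m k"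
proof -
  have A: "A \<in> carrier_mat k k" "det A = 1" using assms by (auto simp: SL_def)
  have B: "adj_mat A \<in> carrier_mat k k" "adj_mat A * A = 1\<^sub>m k"
    using adj_mat[OF A(1)] A(2) by auto
  have "det (adj_mat A) * det A = 1"
    using det_mult[OF B(1) A(1)] B(2) by simp
  then show ?thesis using that B A by (auto simp: SL_def)
qed

lemma path_act_paths:
  assumes A: "A \<in> SL k" and g: "\<gamma> \<in> paths k"
  shows "path_act A \<gamma> \<in> paths k"
proof -
  have Ac: "A \<in> carrier_mat k k" using A by (simp add: SL_def)
  have gc: "\<gamma> i \<in> carrier_vec k" for i using g by (simp add: paths_def)
  have "mat_of_cols k (map (\<lambda>a. path_act A \<gamma> (i + int a)) [0..<k])
          = A * mat_of_cols k (map (\<lambda>a. \<gamma> (i + int a)) [0..<k])" for i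
    using Ac gc by (intro eq_matI) (auto simp: path_act_def mat_of_cols_index)
  then show ?thesis
    using g A Ac gc SL_mult by (auto simp: paths_def path_act_def)
qed

lemma path_act_mult:
  assumes "A \<in> SL k" "B \<in> SL k" "\<gamma> \<in> paths k"
  shows "path_act A (path_act B \<gamma>) = path_act (A * B) \<gamma>"
  using assms by (auto simp: path_act_def SL_def paths_def intro!: ext assoc_mult_mat_vec[symmetric])

lemma path_act_one: "\<gamma> \<in> paths k \<Longrightarrow> path_act (1\<^sub>m k) \<gamma> = \<gamma>"
  by (auto simp: path_act_def paths_def)

lemma equiv_orbit_rel: "equiv (paths k \<times> paths k) (orbit_rel k)"
proof (rule equivI)
  show "orbit_rel k \<subseteq> (paths k \<times> paths k) \<times> (paths k \<times> paths k)"
    by (auto simp: orbit_rel_def)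
  show "refl_on (paths k \<times> paths k) (orbit_rel k)"
    by (auto simp: refl_on_def orbit_rel_def path_act_one intro!: bexI[OF _ SL_one])
  show "sym (orbit_rel k)"
  proof (rule symI)
    fix p q assume pq: "(p, q) \<in> orbit_rel k"
    obtain \<gamma> \<delta> where p: "p = (\<gamma>, \<delta>)" by (cases p)
    from pq obtain A where A: "A \<in> SL k" "\<gamma> \<in> paths k" "\<delta> \<in> paths k"
        "q = (path_act A \<gamma>, path_act A \<delta>)"
      by (auto simp: p orbit_rel_def)
    obtain B where B: "B \<in> SL k" "B * A = 1\<^sub>m k" using SL_inverse[OF A(1)] .
    show "(q, p) \<in> orbit_rel k"
      using A B by (auto simp: p orbit_rel_def path_act_paths path_act_mult path_act_one
          intro!: bexI[OF _ B(1)])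
  qed
  show "trans (orbit_rel k)"
  proof (rule transI)
    fix p q r assume pq: "(p, q) \<in> orbit_rel k" and qr: "(q, r) \<in> orbit_rel k"
    obtain \<gamma> \<delta> where p: "p = (\<gamma>, \<delta>)" by (cases p)
    from pq obtain A where A: "A \<in> SL k" "\<gamma> \<in> paths k" "\<delta> \<in> paths k"
        "q = (path_act A \<gamma>, path_act A \<delta>)"
      by (auto simp: p orbit_rel_def)
    from qr A obtain B where B: "B \<in> SL k"
        "r = (path_act B (path_act A \<gamma>), path_act B (path_act A \<delta>))"
      by (auto simp: orbit_rel_def)
    show "(p, r) \<in> orbit_rel k"
      using A B by (auto simp: p orbit_rel_def path_act_paths path_act_mult
          intro!: bexI[OF _ SL_mult[OF B(1) A(1)]] path_act_paths[OF SL_mult[OF B(1) A(1)]])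
  qed
qed

end

theory Submission
  imports Defs
begin

text \<open>The determinants defining the tiling are pairings \<open>\<rho> i \<bullet> \<delta> j\<close>, where \<open>\<rho> i\<close> is the covector
  \<open>v \<mapsto> det (\<gamma> i, \<dots>, \<gamma> (i + k - 2), v)\<close>. These covectors again form a path, and \<open>\<gamma>\<close> and \<open>\<rho>\<close> determine
  each other through \<open>\<rho> i \<bullet> \<gamma> (i + b) = 0\<close> for \<open>b < k - 1\<close> and \<open>\<rho> i \<bullet> \<gamma> (i + k - 1) = 1\<close>. So a tiling
  in the image of \<open>\<Phi>\<close> is a factorisation \<open>M i j = \<rho> i \<bullet> \<delta> j\<close> into two paths, which is unique up to
  \<open>SL\<^sub>k\<close>. It exists for a tame tiling: read \<open>\<delta>\<close> off the first \<open>k\<close> rows and \<open>\<rho>\<close> off the first \<open>k\<close>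
  columns; the product then agrees with \<open>M\<close> everywhere, because in a \<open>(k + 1) \<times> (k + 1)\<close> block of
  determinant \<open>0\<close> the complementary minor \<open>1\<close> of a corner lets one solve for the corner entry.\<close>

section \<open>Windows of a path\<close>

definition window :: "nat \<Rightarrow> (int \<Rightarrow> int vec) \<Rightarrow> int \<Rightarrow> int mat" where
  "window k \<gamma> i = mat_of_cols k (map (\<lambda>a. \<gamma> (i + int a)) [0..<k])"

lemma window_carrier [simp]: "window k \<gamma> i \<in> carrier_mat k k"
  unfolding window_def by (rule carrier_matI) simp_all

lemma window_dim [simp]: "dim_row (window k \<gamma> i) = k" "dim_col (window k \<gamma> i) = k"
  by (simp_all add: window_def)

lemma window_col:
  assumes "\<gamma> (i + int a) \<in> carrier_vec k" "a < k"
  shows "col (window k \<gamma> i) a = \<gamma> (i + int a)"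
  using assms by (simp add: window_def)

lemma paths_iff_window:
  "\<gamma> \<in> paths k \<longleftrightarrow> (\<forall>i. \<gamma> i \<in> carrier_vec k) \<and> (\<forall>i. det (window k \<gamma> i) = 1)"
  by (auto simp: paths_def SL_def window_def)

lemma paths_carrier: "\<gamma> \<in> paths k \<Longrightarrow> \<gamma> i \<in> carrier_vec k"
  by (simp add: paths_def)

lemma det_window: "\<gamma> \<in> paths k \<Longrightarrow> det (window k \<gamma> i) = 1"
  by (simp add: paths_iff_window)

lemma window_transpose_mult_vec:
  assumes "\<And>a. \<gamma> a \<in> carrier_vec k"
  shows "transpose_mat (window k \<gamma> i) *\<^sub>v x = vec k (\<lambda>a. \<gamma> (i + int a) \<bullet> x)"
  using assms by (intro eq_vecI) (auto simp: window_col)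

lemma adj_mat_inverse:
  assumes "A \<in> carrier_mat n n" "det A = 1"
  shows "A * adj_mat A = 1\<^sub>m n" "adj_mat A * A = 1\<^sub>m n"
  using adj_mat[OF assms(1)] assms(2) by auto

text \<open>The transposed window has determinant 1, so its adjugate is an integral inverse: any
  \<open>k\<close> consecutive path vectors serve as coordinates.\<close>

lemma path_separates:
  assumes g: "\<gamma> \<in> paths k" and x: "x \<in> carrier_vec k" and y: "y \<in> carrier_vec k"
    and eq: "\<And>a. a < k \<Longrightarrow> \<gamma> (i + int a) \<bullet> x = \<gamma> (i + int a) \<bullet> y"
  shows "x = y"
proof -
  let ?A = "transpose_mat (window k \<gamma> i)"
  have A: "?A \<in> carrier_mat k k" by simp
  have det: "det ?A = 1"
    using det_window[OF g] det_transpose[OF window_carrier] by metis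
  have inv: "adj_mat ?A *\<^sub>v (?A *\<^sub>v z) = z" if "z \<in> carrier_vec k" for z
    using assoc_mult_mat_vec[OF adj_mat(1)[OF A] A that] adj_mat_inverse[OF A det]
      one_mult_mat_vec[OF that] by metis
  have "?A *\<^sub>v x = ?A *\<^sub>v y"
    using eq paths_carrier[OF g] by (auto simp: window_transpose_mult_vec)
  then show ?thesis using inv[OF x] inv[OF y] by metis
qed

text \<open>The integral inverse given by the adjugate solves the system over the integers for every
  right-hand side \<open>c\<close>.\<close>

lemma path_solvable:
  assumes g: "\<gamma> \<in> paths k"
  shows "\<exists>x \<in> carrier_vec k. \<forall>a<k. \<gamma> (i + int a) \<bullet> x = c a"
proof -
  let ?A = "transpose_mat (window k \<gamma> i)"
  have A: "?A \<in> carrier_mat k k" by simp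
  have det: "det ?A = 1"
    using det_window[OF g] det_transpose[OF window_carrier] by metis
  let ?x = "adj_mat ?A *\<^sub>v vec k c"
  have x: "?x \<in> carrier_vec k" using adj_mat(1)[OF A] by simp
  have "?A *\<^sub>v ?x = vec k c"
    using assoc_mult_mat_vec[OF A adj_mat(1)[OF A]] adj_mat_inverse[OF A det]
      one_mult_mat_vec vec_carrier by metis
  then have "vec k (\<lambda>a. \<gamma> (i + int a) \<bullet> ?x) = vec k c"
    using paths_carrier[OF g] by (simp add: window_transpose_mult_vec)
  then have "\<gamma> (i + int a) \<bullet> ?x = c a" if "a < k" for a
    using that by (metis index_vec)
  then show ?thesis using x by blast
qed

section \<open>Dual paths\<close>

text \<open>For a path \<gamma> and vectors \<rho> of dimension \<open>k\<close>, this makes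
  \<open>\<rho> i\<close> the last row of the inverse of \<open>window k \<gamma> i\<close>. As a
  linear system it can be solved for either sequence once the other is a path.\<close>

definition dual_paths :: "nat \<Rightarrow> (int \<Rightarrow> int vec) \<Rightarrow> (int \<Rightarrow> int vec) \<Rightarrow> bool" where
  "dual_paths k \<gamma> \<rho> \<longleftrightarrow>
     (\<forall>i. \<forall>b<k. \<rho> i \<bullet> \<gamma> (i + int b) = (if b = k - 1 then 1 else 0))"

lemma transpose_window_mult_window:
  assumes "\<And>a. \<rho> a \<in> carrier_vec k" "\<And>a. \<delta> a \<in> carrier_vec k"
  shows "transpose_mat (window k \<rho> i) * window k \<delta> j = adj_submat k (\<lambda>a b. \<rho> a \<bullet> \<delta> b) i j"
  using assms by (intro eq_matI) (auto simp: adj_submat_def window_col)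

text \<open>The matrix of pairings is a transposed window times a window. This translates between
  determinant 1 for the blocks of a product array and the path condition on its factors.\<close>

lemma det_pairing:
  assumes "\<And>a. \<rho> a \<in> carrier_vec k" "\<And>a. \<delta> a \<in> carrier_vec k"
  shows "det (adj_submat k (\<lambda>a b. \<rho> a \<bullet> \<delta> b) i j) = det (window k \<rho> i) * det (window k \<delta> j)"
  using assms
  by (simp flip: transpose_window_mult_window
      add: det_mult[of _ k] det_transpose[OF window_carrier])

text \<open>The matrix of pairings between \<open>\<rho> i, \<dots>, \<rho> (i + k - 1)\<close> and
  \<open>\<gamma> (i + k - 1), \<dots>, \<gamma> (i + 2 * k - 2)\<close> is upper unitriangular.\<close>

lemma dual_paths_det:
  assumes r: "\<And>a. \<rho> a \<in> carrier_vec k" and g: "\<And>a. \<gamma> a \<in> carrier_vec k"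
    and dual: "dual_paths k \<gamma> \<rho>"
  shows "det (window k \<rho> i) * det (window k \<gamma> (i + int k - 1)) = 1"
proof -
  let ?T = "adj_submat k (\<lambda>a b. \<rho> a \<bullet> \<gamma> b) i (i + int k - 1)"
  have T: "?T \<in> carrier_mat k k" by (simp add: adj_submat_def)
  have entry: "?T $$ (a, b) = (if a = b then 1 else 0)" if "b \<le> a" "a < k" for a b
  proof -
    \<comment> \<open>On and below the diagonal, the \<gamma>-index lies at offset
      \<open>k - 1 - (a - b)\<close> from \<open>i + int a\<close>, within the range that duality
      prescribes; it is the last offset exactly when \<open>a = b\<close>.\<close>
    have idx: "i + int k - 1 + int b = i + int a + int (k - 1 - (a - b))"
      using that by (simp add: of_nat_diff)
    then have "\<rho> (i + int a) \<bullet> \<gamma> (i + int k - 1 + int b) = (if k - 1 - (a - b) = k - 1 then 1 else 0)"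
      using dual[unfolded dual_paths_def, rule_format, of "k - 1 - (a - b)" "i + int a"] that
      unfolding idx by fastforce
    then show ?thesis using that by (auto simp: adj_submat_def)
  qed
  have "upper_triangular ?T"
    using entry T by (intro upper_triangularI) auto
  then have "det ?T = prod_list (diag_mat ?T)" using T by (rule det_upper_triangular)
  also have "diag_mat ?T = replicate k 1"
    using entry T by (intro nth_equalityI) (auto simp: diag_mat_def)
  finally show ?thesis using det_pairing[OF r g] by simp
qed

text \<open>The two window determinants multiply to 1 and that of \<rho> is 1; the shift by
  \<open>k - 1\<close> still reaches every window of \<gamma>.\<close>

lemma dual_paths_left_path:
  assumes "\<rho> \<in> paths k" "\<And>a. \<gamma> a \<in> carrier_vec k" "dual_paths k \<gamma> \<rho>"
  shows "\<gamma> \<in> paths k"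
proof -
  have "det (window k \<gamma> j) = 1" for j
    using dual_paths_det[OF paths_carrier[OF assms(1)] assms(2,3), of "j - int k + 1"]
      det_window[OF assms(1)] by simp
  then show ?thesis using assms(2) by (simp add: paths_iff_window)
qed

lemma dual_paths_right_path:
  assumes "\<gamma> \<in> paths k" "\<And>a. \<rho> a \<in> carrier_vec k" "dual_paths k \<gamma> \<rho>"
  shows "\<rho> \<in> paths k"
  using dual_paths_det[OF assms(2) paths_carrier[OF assms(1)] assms(3)]
    det_window[OF assms(1)] assms(2) by (simp add: paths_iff_window)

lemma dual_paths_right_unique:
  assumes g: "\<gamma> \<in> paths k" and r: "\<And>a. \<rho> a \<in> carrier_vec k" "\<And>a. \<rho>' a \<in> carrier_vec k"
    and dual: "dual_paths k \<gamma> \<rho>" "dual_paths k \<gamma> \<rho>'"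
  shows "\<rho> = \<rho>'"
proof
  fix i
  show "\<rho> i = \<rho>' i"
  proof (rule path_separates[OF g r(1) r(2)])
    fix a assume "a < k"
    then show "\<gamma> (i + int a) \<bullet> \<rho> i = \<gamma> (i + int a) \<bullet> \<rho>' i"
      using dual comm_scalar_prod[OF paths_carrier[OF g] r(1)]
        comm_scalar_prod[OF paths_carrier[OF g] r(2)]
      by (simp add: dual_paths_def)
  qed
qed

text \<open>In reversed indexing, \<open>\<gamma> j\<close> is the solution of \<open>k\<close> unimodular equations.\<close>

lemma dual_paths_iff:
  "dual_paths k \<gamma> \<rho> \<longleftrightarrow>
     (\<forall>j. \<forall>a<k. \<rho> (j - int k + 1 + int a) \<bullet> \<gamma> j = (if a = 0 then 1 else 0))"
  (is "_ \<longleftrightarrow> ?R")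
proof
  assume d: "dual_paths k \<gamma> \<rho>"
  show ?R
  proof (intro allI impI)
    fix j a assume a: "a < k"
    have "j = (j - int k + 1 + int a) + int (k - 1 - a)" using a by (simp add: of_nat_diff)
    then show "\<rho> (j - int k + 1 + int a) \<bullet> \<gamma> j = (if a = 0 then 1 else 0)"
      using d[unfolded dual_paths_def, rule_format, of "k - 1 - a" "j - int k + 1 + int a"] a
      by (auto split: if_splits)
  qed
next
  assume R: ?R
  show "dual_paths k \<gamma> \<rho>"
    unfolding dual_paths_def
  proof (intro allI impI)
    fix i b assume b: "b < k"
    have "i = (i + int b) - int k + 1 + int (k - 1 - b)" using b by (simp add: of_nat_diff)
    then show "\<rho> i \<bullet> \<gamma> (i + int b) = (if b = k - 1 then 1 else 0)"
      using R[rule_format, of "k - 1 - b" "i + int b"] b by (auto split: if_splits)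
  qed
qed

text \<open>Read backwards, duality prescribes the pairings of \<open>\<gamma> j\<close> with the
  window of \<rho> that starts at \<open>j - int k + 1\<close>.\<close>

lemma dual_paths_left_unique:
  assumes r: "\<rho> \<in> paths k" and g: "\<And>a. \<gamma> a \<in> carrier_vec k" "\<And>a. \<gamma>' a \<in> carrier_vec k"
    and dual: "dual_paths k \<gamma> \<rho>" "dual_paths k \<gamma>' \<rho>"
  shows "\<gamma> = \<gamma>'"
proof
  fix j
  show "\<gamma> j = \<gamma>' j"
    using dual
    by (intro path_separates[OF r g(1) g(2), of "j - int k + 1"]) (simp add: dual_paths_iff)
qed

text \<open>The reversed equations are solved separately for each \<open>j\<close>; that the
  solutions fit together into a path then follows from duality alone.\<close>

lemma dual_paths_left_exists:
  assumes r: "\<rho> \<in> paths k"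
  obtains \<gamma> where "\<gamma> \<in> paths k" "dual_paths k \<gamma> \<rho>"
proof -
  have "\<exists>x \<in> carrier_vec k. \<forall>a<k. \<rho> (j - int k + 1 + int a) \<bullet> x = (if a = 0 then 1 else 0)" for j
    by (rule path_solvable[OF r])
  then obtain \<gamma> where g: "\<And>j. \<gamma> j \<in> carrier_vec k"
      "\<And>j a. a < k \<Longrightarrow> \<rho> (j - int k + 1 + int a) \<bullet> \<gamma> j = (if a = 0 then 1 else 0)"
    by metis
  then have "dual_paths k \<gamma> \<rho>" by (simp add: dual_paths_iff)
  then show ?thesis using that dual_paths_left_path[where \<gamma> = \<gamma>, OF r g(1)] by blast
qed

section \<open>The tiling of a pair of paths\<close>

text \<open>The generalised cross product of \<open>k - 1\<close> consecutive path vectors. The zero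
  vector is a placeholder for the last column, which these cofactors do not see.\<close>

definition conormal :: "nat \<Rightarrow> (int \<Rightarrow> int vec) \<Rightarrow> int \<Rightarrow> int vec" where
  "conormal k \<gamma> i = vec k (\<lambda>r.
     cofactor (mat_of_cols k (map (\<lambda>a. \<gamma> (i + int a)) [0..<k - 1] @ [0\<^sub>v k])) r (k - 1))"

lemma conormal_carrier [simp]: "conormal k \<gamma> i \<in> carrier_vec k"
  by (simp add: conormal_def)

text \<open>Laplace expansion along the last column, the only one that contains
  \<open>v\<close>.\<close>

lemma det_eq_conormal:
  assumes v: "v \<in> carrier_vec k" and k: "k > 0"
  shows "det (mat_of_cols k (map (\<lambda>a. \<gamma> (i + int a)) [0..<k - 1] @ [v])) = conormal k \<gamma> i \<bullet> v"
proof -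
  let ?A = "\<lambda>v. mat_of_cols k (map (\<lambda>a. \<gamma> (i + int a)) [0..<k - 1] @ [v])"
  have A: "?A v \<in> carrier_mat k k" for v
    using k by (auto simp: mat_of_cols_def)
  have del: "mat_delete (?A v) r (k - 1) = mat_delete (?A (0\<^sub>v k)) r (k - 1)" for r
    using k by (intro eq_matI) (auto simp: mat_delete_def mat_of_cols_index nth_append)
  have "det (?A v) = (\<Sum>r<k. ?A v $$ (r, k - 1) * cofactor (?A v) r (k - 1))"
    using k by (intro laplace_expansion_column[OF A]) simp
  also have "\<dots> = (\<Sum>r<k. conormal k \<gamma> i $ r * v $ r)"
    using k by (intro sum.cong)
      (auto simp: conormal_def cofactor_def del mat_of_cols_index nth_append simp del: One_nat_def)
  finally show ?thesis
    using v by (simp add: scalar_prod_def lessThan_atLeast0)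
qed

lemma tiling_of_eq:
  assumes "\<delta> j \<in> carrier_vec k" "k > 0"
  shows "tiling_of k (\<gamma>, \<delta>) i j = conormal k \<gamma> i \<bullet> \<delta> j"
  using det_eq_conormal[OF assms] by (simp add: tiling_of_def)

text \<open>The pairing is the determinant with \<open>\<gamma> (i + int b)\<close> as last column:
  a full window if \<open>b = k - 1\<close>, and a matrix with a repeated column otherwise.\<close>

lemma dual_conormal:
  assumes g: "\<gamma> \<in> paths k" and k: "k > 0"
  shows "dual_paths k \<gamma> (conormal k \<gamma>)"
  unfolding dual_paths_def
proof (intro allI impI)
  fix i b assume b: "b < k"
  let ?A = "mat_of_cols k (map (\<lambda>a. \<gamma> (i + int a)) [0..<k - 1] @ [\<gamma> (i + int b)])"
  have A: "?A \<in> carrier_mat k k"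
    using k by (auto simp: mat_of_cols_def)
  have "det ?A = (if b = k - 1 then 1 else 0)"
  proof (cases "b = k - 1")
    case True
    have "[0..<k] = [0..<k - 1] @ [k - 1]"
      using k by (metis Suc_diff_1 upt_Suc_append zero_le)
    then have "?A = window k \<gamma> i"
      using True by (simp add: window_def)
    then show ?thesis using True det_window[OF g] by simp
  next
    case False
    then have b': "b < k - 1" using b by simp
    have "col ?A b = col ?A (k - 1)"
      using b' paths_carrier[OF g] by (subst (1 2) col_mat_of_cols) (auto simp: nth_append)
    then have "det ?A = 0"
      using b' by (intro det_identical_columns[OF A, of b "k - 1"]) auto
    then show ?thesis using False by simp
  qed
  then show "conormal k \<gamma> i \<bullet> \<gamma> (i + int b) = (if b = k - 1 then 1 else 0)"
    using det_eq_conormal[OF paths_carrier[OF g] k] by simp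
qed

lemma conormal_path: "\<gamma> \<in> paths k \<Longrightarrow> k > 0 \<Longrightarrow> conormal k \<gamma> \<in> paths k"
  using dual_paths_right_path dual_conormal by simp

text \<open>Padding the two factors of size \<open>(k + 1) \<times> k\<close> and \<open>k \<times> (k + 1)\<close> with zeros makes them square
  and singular.\<close>

lemma det_pairing_Suc:
  assumes r: "\<And>a. \<rho> a \<in> carrier_vec k" and d: "\<And>a. \<delta> a \<in> carrier_vec k"
  shows "det (adj_submat (k + 1) (\<lambda>a b. \<rho> a \<bullet> \<delta> b) i j) = 0"
proof -
  let ?n = "k + 1"
  let ?A = "mat ?n ?n (\<lambda>(a, b). if b < k then \<rho> (i + int a) $ b else 0)"
  let ?B = "mat ?n ?n (\<lambda>(a, b). if a < k then \<delta> (j + int b) $ a else 0)"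
  have AB: "?A \<in> carrier_mat ?n ?n" "?B \<in> carrier_mat ?n ?n" by auto
  have "adj_submat ?n (\<lambda>a b. \<rho> a \<bullet> \<delta> b) i j = ?A * ?B"
  proof (rule eq_matI)
    fix a b assume "a < dim_row (?A * ?B)" "b < dim_col (?A * ?B)"
    then show "adj_submat ?n (\<lambda>a b. \<rho> a \<bullet> \<delta> b) i j $$ (a, b) = (?A * ?B) $$ (a, b)"
      using carrier_vecD[OF d] by (auto simp: adj_submat_def scalar_prod_def)
  qed (auto simp: adj_submat_def)
  moreover have "det ?A = (\<Sum>a<?n. ?A $$ (a, k) * cofactor ?A a k)"
    by (rule laplace_expansion_column[OF AB(1)]) simp
  then have "det ?A = 0" by simp
  ultimately show ?thesis using det_mult[OF AB] by simp
qed

section \<open>The map on pairs of paths: values, invariance and injectivity up to the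
  action\<close>

lemma tiling_of_tame:
  assumes p: "\<gamma> \<in> paths k" "\<delta> \<in> paths k" and k: "k > 0"
  shows "tiling_of k (\<gamma>, \<delta>) \<in> tame_SL_tilings k"
proof -
  have eq: "tiling_of k (\<gamma>, \<delta>) = (\<lambda>i j. conormal k \<gamma> i \<bullet> \<delta> j)"
    using tiling_of_eq[OF paths_carrier[OF p(2)] k] by (intro ext) simp
  show ?thesis
    unfolding eq tame_SL_tilings_def SL_tiling_def tame_def
    using det_pairing[OF conormal_carrier paths_carrier[OF p(2)]]
      det_pairing_Suc[OF conormal_carrier paths_carrier[OF p(2)]]
      det_window[OF conormal_path[OF p(1) k]] det_window[OF p(2)]
    by simp
qed

lemma tiling_of_act:
  assumes A: "A \<in> SL k" and p: "\<gamma> \<in> paths k" "\<delta> \<in> paths k" and k: "k > 0"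
  shows "tiling_of k (path_act A \<gamma>, path_act A \<delta>) = tiling_of k (\<gamma>, \<delta>)"
proof (intro ext)
  fix i j
  let ?M = "mat_of_cols k (map (\<lambda>a. \<gamma> (i + int a)) [0..<k - 1] @ [\<delta> j])"
  let ?M' = "mat_of_cols k (map (\<lambda>a. path_act A \<gamma> (i + int a)) [0..<k - 1] @ [path_act A \<delta> j])"
  have Ac: "A \<in> carrier_mat k k" "det A = 1" using A by (auto simp: SL_def)
  have M: "?M \<in> carrier_mat k k" using k by (auto simp: mat_of_cols_def)
  have "?M' = A * ?M"
    using Ac k paths_carrier[OF p(1)] paths_carrier[OF p(2)]
    by (intro eq_matI) (auto simp: path_act_def mat_of_cols_index nth_append col_mat_of_cols)
  then have "det ?M' = det ?M"
    using det_mult[OF Ac(1) M] Ac(2) by simp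
  then show "tiling_of k (path_act A \<gamma>, path_act A \<delta>) i j = tiling_of k (\<gamma>, \<delta>) i j"
    by (simp add: tiling_of_def)
qed

lemma tiling_of_eqD:
  assumes p: "\<gamma> \<in> paths k" "\<delta> \<in> paths k" "\<gamma>' \<in> paths k" "\<delta>' \<in> paths k" and k: "k > 0"
    and eq: "tiling_of k (\<gamma>, \<delta>) = tiling_of k (\<gamma>', \<delta>')"
  obtains A where "A \<in> SL k" "\<gamma>' = path_act A \<gamma>" "\<delta>' = path_act A \<delta>"
proof -
  note c = p[THEN paths_carrier]
  define \<rho> where "\<rho> = conormal k \<gamma>"
  define \<rho>' where "\<rho>' = conormal k \<gamma>'"
  have r: "\<rho> \<in> paths k" "\<rho>' \<in> paths k"
    using conormal_path p k by (auto simp: \<rho>_def \<rho>'_def)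
  note rc = r[THEN paths_carrier]
  have pair: "\<rho> i \<bullet> \<delta> j = \<rho>' i \<bullet> \<delta>' j" for i j
    using fun_cong[OF fun_cong[OF eq], of i j] tiling_of_eq[OF c(2) k] tiling_of_eq[OF c(4) k]
    by (simp add: \<rho>_def \<rho>'_def)
  let ?D = "window k \<delta> 0"
  \<comment> \<open>The only candidate: \<open>A\<close> must carry the window of \<delta> at 0 to
    that of \<delta>'. The adjugate keeps it integral.\<close>
  define A where "A = window k \<delta>' 0 * adj_mat ?D"
  have D: "adj_mat ?D \<in> carrier_mat k k" "adj_mat ?D * ?D = 1\<^sub>m k"
    using adj_mat(1) adj_mat_inverse(2) det_window[OF p(2)] window_carrier by blast+
  have Ac: "A \<in> carrier_mat k k" using mult_carrier_mat[OF window_carrier D(1)] by (simp add: A_def)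
  have AD: "A * ?D = window k \<delta>' 0"
    using assoc_mult_mat[OF window_carrier D(1) window_carrier] D(2)
      right_mult_one_mat[OF window_carrier] by (simp add: A_def)
  have "det A = 1"
    using det_mult[OF Ac window_carrier[of k \<delta> 0]] AD det_window p by simp
  then have ASL: "A \<in> SL k" using Ac by (simp add: SL_def)
  have A0: "A *\<^sub>v \<delta> (0 + int a) = \<delta>' (0 + int a)" if "a < k" for a
  proof -
    have "col (A * ?D) a = A *\<^sub>v col ?D a"
      using that by (intro col_mult2[OF Ac window_carrier])
    then show ?thesis using that AD window_col[OF c(2)] window_col[OF c(4)] by simp
  qed
  have At: "transpose_mat A *\<^sub>v \<rho>' i \<in> carrier_vec k" for i
    using Ac rc(2) by (meson mult_mat_vec_carrier transpose_carrier_mat)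
  have adjoint: "(transpose_mat A *\<^sub>v \<rho>' i) \<bullet> x = \<rho>' i \<bullet> (A *\<^sub>v x)" if "x \<in> carrier_vec k" for i x
    using transpose_vec_mult_scalar[OF Ac that rc(2)] .
  \<comment> \<open>The covectors transform contragrediently. Testing on the window of \<delta> at 0
    suffices, and there the effect of \<open>A\<close> is known.\<close>
  have \<rho>_eq: "transpose_mat A *\<^sub>v \<rho>' i = \<rho> i" for i
  proof (rule path_separates[OF p(2) At rc(1), of 0])
    fix a assume a: "a < k"
    have "(transpose_mat A *\<^sub>v \<rho>' i) \<bullet> \<delta> (0 + int a) = \<rho> i \<bullet> \<delta> (0 + int a)"
      using adjoint[OF c(2)] A0[OF a] pair by metis
    then show "\<delta> (0 + int a) \<bullet> (transpose_mat A *\<^sub>v \<rho>' i) = \<delta> (0 + int a) \<bullet> \<rho> i"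
      using comm_scalar_prod[OF At c(2)] comm_scalar_prod[OF rc(1) c(2)] by metis
  qed
  have pairA: "\<rho>' i \<bullet> path_act A \<epsilon> j = \<rho> i \<bullet> \<epsilon> j" if "\<epsilon> j \<in> carrier_vec k" for \<epsilon> i j
    using adjoint[OF that] \<rho>_eq by (simp add: path_act_def)
  have act: "path_act A \<gamma> \<in> paths k" "path_act A \<delta> \<in> paths k"
    using path_act_paths[OF ASL] p by auto
  \<comment> \<open>Beyond the initial window, \<delta>' is compared with the image of \<delta> by
    pairing both with the path \<rho>'.\<close>
  have "\<delta>' j = path_act A \<delta> j" for j
    using pair pairA[OF c(2)]
    by (intro path_separates[OF r(2) c(4) paths_carrier[OF act(2)], of 0]) simp
  \<comment> \<open>Both \<gamma>' and the image of \<gamma> are dual to \<rho>', hence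
    equal.\<close>
  moreover have "dual_paths k (path_act A \<gamma>) \<rho>'"
    using dual_conormal[OF p(1) k] pairA[OF c(1)] by (simp add: dual_paths_def \<rho>_def)
  then have "\<gamma>' = path_act A \<gamma>"
    using dual_conormal[OF p(3) k]
    by (intro dual_paths_left_unique[OF r(2) c(3) paths_carrier[OF act(1)]]) (auto simp: \<rho>'_def)
  ultimately show ?thesis using that[OF ASL] by blast
qed

section \<open>Factoring a tame tiling\<close>

text \<open>Expanded along row \<open>r\<close>, the determinant is affine in the entry at
  \<open>(r, c)\<close> with slope its cofactor. The cofactors of row \<open>r\<close> ignore that
  row, so they agree for both matrices, and the nonzero slope cancels.\<close>

lemma det_determines_entry:
  fixes A B :: "'a :: idom mat"
  assumes A: "A \<in> carrier_mat n n" and B: "B \<in> carrier_mat n n" and rc: "r < n" "c < n"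
    and eq: "\<And>a b. a < n \<Longrightarrow> b < n \<Longrightarrow> (a, b) \<noteq> (r, c) \<Longrightarrow> A $$ (a, b) = B $$ (a, b)"
    and det: "det A = det B" and minor: "det (mat_delete A r c) \<noteq> 0"
  shows "A $$ (r, c) = B $$ (r, c)"
proof -
  have cof: "cofactor A r b = cofactor B r b" if "b < n" for b
  proof -
    have "mat_delete A r b = mat_delete B r b"
      using A B eq by (intro eq_matI) (auto simp: mat_delete_def)
    then show ?thesis by (simp add: cofactor_def)
  qed
  have "(\<Sum>b<n. A $$ (r, b) * cofactor A r b) = (\<Sum>b<n. B $$ (r, b) * cofactor B r b)"
    using laplace_expansion_row[OF A rc(1)] laplace_expansion_row[OF B rc(1)] det by simp
  then have "A $$ (r, c) * cofactor A r c + (\<Sum>b\<in>{..<n} - {c}. A $$ (r, b) * cofactor A r b)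
           = B $$ (r, c) * cofactor B r c + (\<Sum>b\<in>{..<n} - {c}. B $$ (r, b) * cofactor B r b)"
    using rc by (simp add: sum.remove[of "{..<n}" c])
  moreover have "(\<Sum>b\<in>{..<n} - {c}. A $$ (r, b) * cofactor A r b)
               = (\<Sum>b\<in>{..<n} - {c}. B $$ (r, b) * cofactor B r b)"
    using eq rc cof by (intro sum.cong) auto
  ultimately have "A $$ (r, c) * cofactor A r c = B $$ (r, c) * cofactor A r c"
    using cof rc by simp
  then show ?thesis using minor by (simp add: cofactor_def)
qed

text \<open>Induction moves a whole window of \<open>k\<close> consecutive integers one step at a
  time in both directions. Offsets up to \<open>k\<close> with one end omitted match the corner
  indices \<open>0\<close> and \<open>k\<close> used for blocks of a tiling.\<close>

lemma int_window_induct: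
  fixes Q :: "int \<Rightarrow> bool"
  assumes base: "\<And>a. a < k \<Longrightarrow> Q (int a)"
    and up: "\<And>j. (\<And>a. a \<le> k \<Longrightarrow> a \<noteq> k \<Longrightarrow> Q (j + int a)) \<Longrightarrow> Q (j + int k)"
    and down: "\<And>j. (\<And>a. a \<le> k \<Longrightarrow> a \<noteq> 0 \<Longrightarrow> Q (j + int a)) \<Longrightarrow> Q (j + int 0)"
  shows "Q j"
proof -
  have "\<forall>a<k. Q (j + int a)" for j
  proof (induction j rule: int_induct[where k = 0])
    case base
    then show ?case using assms(1) by simp
  next
    case (step1 j)
    have "Q (j + int k)" using step1(2) by (intro up) simp
    then have "Q (j + int (Suc a))" if "a < k" for a
      using step1(2)[rule_format, of "Suc a"] that by (cases "Suc a = k") auto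
    then show ?case by (simp add: algebra_simps)
  next
    case (step2 j)
    have "Q (j - 1 + int a)" if "a \<le> k" "a \<noteq> 0" for a
      using step2(2)[rule_format, of "a - 1"] that by (simp add: of_nat_diff algebra_simps)
    then have "Q (j - 1)" using down[of "j - 1"] by simp
    then have "Q (j - 1 + int a)" if "a < k" for a
      using step2(2)[rule_format, of "a - 1"] that
      by (cases "a = 0") (simp_all add: of_nat_diff algebra_simps)
    then show ?case by simp
  qed
  \<comment> \<open>An empty window carries no information, but then \<open>up\<close> has no
    assumptions to discharge.\<close>
  moreover have "Q j" if "k = 0" using up[of j] that by simp
  ultimately show ?thesis by (metis add.right_neutral neq0_conv of_nat_0)
qed

text \<open>Removing the row and column of a corner leaves an adjacent \<open>k\<close>-block of
  \<open>M\<close>, of determinant 1; both full blocks have determinant 0.\<close>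

lemma tame_tiling_corner:
  assumes M: "M \<in> tame_SL_tilings k" and N: "tame k N"
    and r: "r \<in> {0, k}" and c: "c \<in> {0, k}"
    and eq: "\<And>a b. a \<le> k \<Longrightarrow> b \<le> k \<Longrightarrow> (a, b) \<noteq> (r, c) \<Longrightarrow>
               M (i + int a) (j + int b) = N (i + int a) (j + int b)"
  shows "M (i + int r) (j + int c) = N (i + int r) (j + int c)"
proof -
  let ?A = "adj_submat (k + 1) M i j" and ?B = "adj_submat (k + 1) N i j"
  have car: "adj_submat n L i j \<in> carrier_mat n n" for n L i j by (simp add: adj_submat_def)
  have "mat_delete ?A r c
      = adj_submat k M (i + (if r = 0 then 1 else 0)) (j + (if c = 0 then 1 else 0))"
    using r c by (intro eq_matI) (auto simp: adj_submat_def mat_delete_def algebra_simps)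
  then have minor: "det (mat_delete ?A r c) = 1"
    using M by (simp add: tame_SL_tilings_def SL_tiling_def)
  have "?A $$ (r, c) = ?B $$ (r, c)"
  proof (rule det_determines_entry[OF car car])
    show "r < k + 1" "c < k + 1" using r c by auto
    show "det ?A = det ?B" using M N by (simp add: tame_SL_tilings_def tame_def)
    show "det (mat_delete ?A r c) \<noteq> 0" using minor by simp
    fix a b assume "a < k + 1" "b < k + 1" "(a, b) \<noteq> (r, c)"
    then show "?A $$ (a, b) = ?B $$ (a, b)" using eq[of a b] by (simp add: adj_submat_def)
  qed
  then show ?thesis using r c by (auto simp: adj_submat_def)
qed

text \<open>In a strip of \<open>k + 1\<close> rows, an outer row spreads left and right from
  \<open>k\<close> seed entries, one corner at a time.\<close>

lemma tame_tiling_row: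
  assumes M: "M \<in> tame_SL_tilings k" and N: "tame k N" and r: "r \<in> {0, k}"
    and rows: "\<And>a j. a \<le> k \<Longrightarrow> a \<noteq> r \<Longrightarrow> M (i + int a) j = N (i + int a) j"
    and cols: "\<And>b. b < k \<Longrightarrow> M (i + int r) (int b) = N (i + int r) (int b)"
  shows "M (i + int r) j = N (i + int r) j"
proof (rule int_window_induct[where k = k and Q = "\<lambda>j. M (i + int r) j = N (i + int r) j"])
  fix j
  assume eq: "\<And>a. a \<le> k \<Longrightarrow> a \<noteq> k \<Longrightarrow> M (i + int r) (j + int a) = N (i + int r) (j + int a)"
  show "M (i + int r) (j + int k) = N (i + int r) (j + int k)"
    by (rule tame_tiling_corner[OF M N r]) (use rows eq in auto)
next
  fix j
  assume eq: "\<And>a. a \<le> k \<Longrightarrow> a \<noteq> 0 \<Longrightarrow> M (i + int r) (j + int a) = N (i + int r) (j + int a)"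
  show "M (i + int r) (j + int 0) = N (i + int r) (j + int 0)"
    by (rule tame_tiling_corner[OF M N r]) (use rows eq in auto)
qed (rule cols)

text \<open>Agreement spreads row by row upwards and downwards; the first \<open>k\<close> columns
  seed each new row.\<close>

lemma tame_tiling_unique:
  assumes M: "M \<in> tame_SL_tilings k" and N: "tame k N"
    and rows: "\<And>a j. a < k \<Longrightarrow> M (int a) j = N (int a) j"
    and cols: "\<And>i b. b < k \<Longrightarrow> M i (int b) = N i (int b)"
  shows "M = N"
proof -
  have "\<forall>j. M i j = N i j" for i
  proof (rule int_window_induct[where k = k and Q = "\<lambda>i. \<forall>j. M i j = N i j"])
    fix i assume eq: "\<And>a. a \<le> k \<Longrightarrow> a \<noteq> k \<Longrightarrow> \<forall>j. M (i + int a) j = N (i + int a) j"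
    show "\<forall>j. M (i + int k) j = N (i + int k) j"
      by (rule allI, rule tame_tiling_row[OF M N]) (use cols eq in auto)
  next
    fix i assume eq: "\<And>a. a \<le> k \<Longrightarrow> a \<noteq> 0 \<Longrightarrow> \<forall>j. M (i + int a) j = N (i + int a) j"
    show "\<forall>j. M (i + int 0) j = N (i + int 0) j"
      by (rule allI, rule tame_tiling_row[OF M N]) (use cols eq in auto)
  qed (use rows in blast)
  then show ?thesis by blast
qed

lemma tame_tiling_factors:
  assumes M: "M \<in> tame_SL_tilings k"
  obtains \<rho> \<delta> where "\<rho> \<in> paths k" "\<delta> \<in> paths k" "M = (\<lambda>i j. \<rho> i \<bullet> \<delta> j)"
proof -
  have SL: "det (adj_submat k M i j) = 1" for i j
    using M by (simp add: tame_SL_tilings_def SL_tiling_def)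
  define \<delta> where "\<delta> = (\<lambda>j. vec k (\<lambda>a. M (int a) j))"
  have dc: "\<delta> j \<in> carrier_vec k" for j by (simp add: \<delta>_def)
  have "window k \<delta> j = adj_submat k M 0 j" for j
    by (intro eq_matI) (auto simp: window_def adj_submat_def \<delta>_def mat_of_cols_index)
  then have d: "\<delta> \<in> paths k" using SL dc by (simp add: paths_iff_window)
  have "\<exists>x \<in> carrier_vec k. \<forall>a<k. \<delta> (0 + int a) \<bullet> x = M i (int a)" for i
    by (rule path_solvable[OF d])
  then obtain \<rho> where rc: "\<And>i. \<rho> i \<in> carrier_vec k"
      and r0: "\<And>i a. a < k \<Longrightarrow> \<delta> (0 + int a) \<bullet> \<rho> i = M i (int a)"
    by metis
  have cols: "M i (int b) = \<rho> i \<bullet> \<delta> (int b)" if "b < k" for i b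
    using r0[OF that] comm_scalar_prod[OF dc rc] by simp
  have rows: "M (int a) j = \<rho> (int a) \<bullet> \<delta> j" if a: "a < k" for a j
  proof -
    \<comment> \<open>The unit vector picks entry \<open>a\<close> of each
      \<open>\<delta> j\<close>, so it solves the equations that define
      \<open>\<rho> (int a)\<close>.\<close>
    have "\<rho> (int a) = unit_vec k a"
      using a r0 by (intro path_separates[OF d rc, of _ 0]) (simp_all add: \<delta>_def)
    then show ?thesis using a by (simp add: \<delta>_def)
  qed
  have "tame k (\<lambda>i j. \<rho> i \<bullet> \<delta> j)"
    unfolding tame_def using det_pairing_Suc[where \<rho> = \<rho> and \<delta> = \<delta>, OF rc dc] by blast
  then have fac: "M = (\<lambda>i j. \<rho> i \<bullet> \<delta> j)"
    using tame_tiling_unique[OF M] rows cols by blast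
  \<comment> \<open>The block at \<open>(i, 0)\<close> has determinant 1, and so has the window of
    \<delta> at 0.\<close>
  have "det (window k \<rho> i) = 1" for i
    using det_pairing[where \<rho> = \<rho> and \<delta> = \<delta>, OF rc dc, of i 0] SL[of i 0] det_window[OF d] by (simp flip: fac)
  then have "\<rho> \<in> paths k" using rc by (simp add: paths_iff_window)
  then show ?thesis using that d fac by blast
qed

text \<open>The factor \<rho> must be realised as a conormal: its left dual \<gamma> works, since
  the right dual of \<gamma> is unique.\<close>

lemma tiling_of_surj:
  assumes M: "M \<in> tame_SL_tilings k" and k: "k > 0"
  obtains \<gamma> \<delta> where "\<gamma> \<in> paths k" "\<delta> \<in> paths k" "tiling_of k (\<gamma>, \<delta>) = M"
proof -
  obtain \<rho> \<delta> where r: "\<rho> \<in> paths k" and d: "\<delta> \<in> paths k" and fac: "M = (\<lambda>i j. \<rho> i \<bullet> \<delta> j)"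
    using tame_tiling_factors[OF M] .
  obtain \<gamma> where g: "\<gamma> \<in> paths k" and dual: "dual_paths k \<gamma> \<rho>"
    using dual_paths_left_exists[OF r] .
  have "conormal k \<gamma> = \<rho>"
    using dual_paths_right_unique[OF g conormal_carrier paths_carrier[OF r] dual_conormal[OF g k] dual] .
  then have "tiling_of k (\<gamma>, \<delta>) = M"
    using tiling_of_eq[OF paths_carrier[OF d] k] fac by (intro ext) simp
  then show ?thesis using that g d by blast
qed

section \<open>Passage to orbits\<close>

theorem theorem1p1:
  fixes k :: nat
  assumes "k \<ge> 2"
  shows "tiling_of k respects orbit_rel k \<and>
         bij_betw (Phi k) ((paths k \<times> paths k) // orbit_rel k) (tame_SL_tilings k)"
proof
  let ?P = "paths k \<times> paths k"
  have k: "k > 0" using assms by simp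
  show resp: "tiling_of k respects orbit_rel k"
    using tiling_of_act[OF _ _ _ k] by (auto simp: congruent_def orbit_rel_def)
  \<comment> \<open>By invariance the image of an orbit is a singleton, so \<open>the_elem\<close>
    returns its actual value.\<close>
  have Phi: "Phi k (orbit_rel k `` {p}) = tiling_of k p" if "p \<in> ?P" for p
  proof -
    have "tiling_of k ` (orbit_rel k `` {p}) = {tiling_of k p}"
      using equiv_class_self[OF equiv_orbit_rel that] resp
      by (fastforce simp: congruent_def)
    then show ?thesis by (simp add: Phi_def)
  qed
  have rel: "(p, q) \<in> orbit_rel k" if "p \<in> ?P" "q \<in> ?P" "tiling_of k p = tiling_of k q" for p q
  proof -
    obtain \<gamma> \<delta> \<gamma>' \<delta>' where pq: "p = (\<gamma>, \<delta>)" "q = (\<gamma>', \<delta>')" by (cases p, cases q)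
    with that have "\<gamma> \<in> paths k" "\<delta> \<in> paths k" "\<gamma>' \<in> paths k" "\<delta>' \<in> paths k"
        "tiling_of k (\<gamma>, \<delta>) = tiling_of k (\<gamma>', \<delta>')"
      by auto
    then obtain A where "A \<in> SL k" "\<gamma>' = path_act A \<gamma>" "\<delta>' = path_act A \<delta>"
      using tiling_of_eqD k by blast
    then show ?thesis using that pq by (auto simp: orbit_rel_def)
  qed
  show "bij_betw (Phi k) (?P // orbit_rel k) (tame_SL_tilings k)"
  proof (rule bij_betw_imageI)
    show "inj_on (Phi k) (?P // orbit_rel k)"
    proof (rule inj_onI)
      fix X Y assume "X \<in> ?P // orbit_rel k" "Y \<in> ?P // orbit_rel k" and eq: "Phi k X = Phi k Y"
      then obtain p q where "p \<in> ?P" "X = orbit_rel k `` {p}" "q \<in> ?P" "Y = orbit_rel k `` {q}"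
        by (elim quotientE)
      then show "X = Y"
        using eq Phi rel equiv_class_eq[OF equiv_orbit_rel] by metis
    qed
    show "Phi k ` (?P // orbit_rel k) = tame_SL_tilings k"
    proof (intro equalityI subsetI)
      fix M assume "M \<in> Phi k ` (?P // orbit_rel k)"
      then show "M \<in> tame_SL_tilings k"
        using Phi tiling_of_tame[OF _ _ k] by (auto elim!: quotientE)
    next
      fix M assume "M \<in> tame_SL_tilings k"
      then obtain \<gamma> \<delta> where p: "(\<gamma>, \<delta>) \<in> ?P" "tiling_of k (\<gamma>, \<delta>) = M"
        using tiling_of_surj[OF _ k] by blast
      then show "M \<in> Phi k ` (?P // orbit_rel k)"
        using Phi[OF p(1)] quotientI[OF p(1)] by (metis imageI)
    qed
  qed
qed

end
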